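(* An evolution algebra $A$ over a field $K$ is von Neumann regular if and only if every graph associated to $A$ (relative to any natural basis of $A$) consists of isolated loops, i.e., its edges are exactly one loop at each vertex.
   Context: Algebras are not assumed associative. An evolution algebra over $K$ is a $K$-algebra $A$ having a basis $B=\{e_i\}_{i\in\Lambda}$ (a natural basis) with $e_ie_j=0$ for all $i\ne j$; it is commutative. Write $e_i^2=\sum_{j\in\Lambda}\omega_{ji}e_j$. The directed graph associated to $A$ relative to $B$ has vertex set $\{e_i\}_{i\in\Lambda}$ and exactly one edge from $e_i$ to $e_j$ if $\omega_{ji}\neq 0$, and none otherwise. An element $x\in A$ is von Neumann regular if there is $y\in A$ with $(xy)x=x$ (by commutativity $(xy)x=x(yx)$). $A$ is von Neumann regular if every element of $A$ is. *)

theory Defs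
  imports "Graph_Theory.Pair_Digraph"
begin

text \<open>Algebras over a field, with no associativity, commutativity or unit assumed. The underlying
  space is the whole type \<open>'a\<close>; it may be infinite-dimensional or zero.\<close>

locale nonassoc_algebra = vector_space scale
  for scale :: "'k::field \<Rightarrow> 'a::ab_group_add \<Rightarrow> 'a" +
  fixes mul :: "'a \<Rightarrow> 'a \<Rightarrow> 'a"
  assumes mul_add_left: "mul (x + y) z = mul x z + mul y z"
    and mul_add_right: "mul x (y + z) = mul x y + mul x z"
    and mul_scale_left: "mul (scale c x) y = scale c (mul x y)"
    and mul_scale_right: "mul x (scale c y) = scale c (mul x y)"

text \<open>The basis is taken as a set of vectors (a Hamel basis) rather than as an indexed family; the
  vertices of the associated graph are the basis vectors themselves.\<close>

definition natural_basis ::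
  "('k::field \<Rightarrow> 'a::ab_group_add \<Rightarrow> 'a) \<Rightarrow> ('a \<Rightarrow> 'a \<Rightarrow> 'a) \<Rightarrow> 'a set \<Rightarrow> bool" where
  "natural_basis scale mul B \<longleftrightarrow>
     \<not> module.dependent scale B \<and> module.span scale B = UNIV \<and>
     (\<forall>e\<in>B. \<forall>f\<in>B. e \<noteq> f \<longrightarrow> mul e f = 0)"

locale evolution_algebra = nonassoc_algebra scale mul
  for scale :: "'k::field \<Rightarrow> 'a::ab_group_add \<Rightarrow> 'a" and mul :: "'a \<Rightarrow> 'a \<Rightarrow> 'a" +
  assumes ex_natural_basis: "\<exists>B. natural_basis scale mul B"

text \<open>For \<open>e = e\<^sub>i\<close> and \<open>f = e\<^sub>j\<close> this is \<open>\<omega>\<^sub>j\<^sub>i\<close>, the coefficient of \<open>e\<^sub>j\<close> in \<open>e\<^sub>i\<^sup>2\<close>;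
  note that the order of the arguments is that of the edge, not of the indices.\<close>

definition structure_const ::
  "('k::field \<Rightarrow> 'a::ab_group_add \<Rightarrow> 'a) \<Rightarrow> ('a \<Rightarrow> 'a \<Rightarrow> 'a) \<Rightarrow> 'a set \<Rightarrow> 'a \<Rightarrow> 'a \<Rightarrow> 'k" where
  "structure_const scale mul B e f = module.representation scale B (mul e e) f"

definition associated_graph ::
  "('k::field \<Rightarrow> 'a::ab_group_add \<Rightarrow> 'a) \<Rightarrow> ('a \<Rightarrow> 'a \<Rightarrow> 'a) \<Rightarrow> 'a set \<Rightarrow> 'a pair_pre_digraph" where
  "associated_graph scale mul B =
     \<lparr> pverts = B,
       parcs = {(e, f). e \<in> B \<and> f \<in> B \<and> structure_const scale mul B e f \<noteq> 0} \<rparr>"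

text \<open>A pair digraph has no parallel arcs, so this says exactly one loop at each vertex and no
  other arcs.\<close>

definition isolated_loops :: "'v pair_pre_digraph \<Rightarrow> bool" where
  "isolated_loops G \<longleftrightarrow> parcs G = {(v, v) | v. v \<in> pverts G}"

definition von_neumann_regular_element :: "('a \<Rightarrow> 'a \<Rightarrow> 'a) \<Rightarrow> 'a \<Rightarrow> bool" where
  "von_neumann_regular_element mul x \<longleftrightarrow> (\<exists>y. mul (mul x y) x = x)"

definition von_neumann_regular :: "('a \<Rightarrow> 'a \<Rightarrow> 'a) \<Rightarrow> bool" where
  "von_neumann_regular mul \<longleftrightarrow> (\<forall>x. von_neumann_regular_element mul x)"

end

theory Submission
  imports Defs
begin

text \<open>Let \<open>B\<close> be a natural basis. Its graph consists of isolated loops exactly when every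
  \<open>e \<in> B\<close> is an eigenvector of its own multiplication, \<open>e\<^sup>2 = c e\<close> with \<open>c \<noteq> 0\<close>
  (\<open>isolated_loops_iff_squares\<close>), and regularity of the algebra can be read off from these
  equations.

  If the algebra is regular and \<open>e \<in> B\<close>, choose \<open>y\<close> with \<open>(ey)e = e\<close>. Because \<open>e\<close> kills the
  rest of the basis, both \<open>eA\<close> and \<open>Ae\<close> lie in the line through \<open>e\<^sup>2\<close>; hence \<open>e = (ey)e\<close> is a
  multiple of \<open>e\<^sup>2\<close>, and as \<open>e \<noteq> 0\<close> this can be inverted
  (\<open>square_of_regular_basis_element\<close>).

  If conversely \<open>e\<^sup>2 = w\<^sub>e e\<close> with \<open>w\<^sub>e \<noteq> 0\<close> for all \<open>e \<in> B\<close>, then the product is computed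
  coordinatewise up to these scalars, and \<open>(xy)x = x\<close> becomes the scalar condition
  \<open>x\<^sub>e\<^sup>2 y\<^sub>e w\<^sub>e\<^sup>2 = x\<^sub>e\<close>. It is solved by \<open>y\<^sub>e = 1 / (x\<^sub>e w\<^sub>e\<^sup>2)\<close> on the finite support of \<open>x\<close> and
  \<open>y\<^sub>e = 0\<close> off it (\<open>regular_if_squares\<close>).\<close>

context nonassoc_algebra
begin

lemma mul_zero_left: "mul 0 y = 0"
  using mul_add_left[of 0 0 y] by simp

lemma mul_zero_right: "mul x 0 = 0"
  using mul_add_right[of x 0 0] by simp

lemma mul_sum_left: "mul (sum f S) y = (\<Sum>s\<in>S. mul (f s) y)"
  by (induction S rule: infinite_finite_induct) (simp_all add: mul_zero_left mul_add_left)

lemma mul_sum_right: "mul x (sum f S) = (\<Sum>s\<in>S. mul x (f s))"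
  by (induction S rule: infinite_finite_induct) (simp_all add: mul_zero_right mul_add_right)

text \<open>Of the summands of \<open>y\<close> only the multiple of \<open>e\<close> survives multiplication by \<open>e\<close>, so
  \<open>c\<close> is the coordinate of \<open>y\<close> at \<open>e\<close>.\<close>

lemma mul_basis_left:
  assumes "natural_basis scale mul B" and "e \<in> B"
  shows "\<exists>c. mul e y = scale c (mul e e)"
proof -
  have "y \<in> span B"
    using assms(1) by (simp add: natural_basis_def)
  then show ?thesis
  proof (induction rule: span_induct_alt)
    case base
    show ?case
      by (rule exI[of _ 0]) (simp add: mul_zero_right)
  next
    case (step a b y)
    then obtain c where c: "mul e y = scale c (mul e e)"
      by blast
    show ?case
    proof (cases "b = e")
      case True
      then have "mul e (scale a b + y) = scale (a + c) (mul e e)"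
        by (simp add: c mul_add_right mul_scale_right scale_left_distrib)
      then show ?thesis by blast
    next
      case False
      then have "mul e b = 0"
        using assms step(1) by (auto simp: natural_basis_def)
      then have "mul e (scale a b + y) = scale c (mul e e)"
        by (simp add: c mul_add_right mul_scale_right)
      then show ?thesis by blast
    qed
  qed
qed

text \<open>The mirror image of the previous lemma follows from it by passing to the opposite algebra,
  which has the same natural bases and the same squares.\<close>

lemma mul_basis_right:
  assumes "natural_basis scale mul B" and "e \<in> B"
  shows "\<exists>c. mul y e = scale c (mul e e)"
proof -
  interpret opposite: nonassoc_algebra scale "\<lambda>x y. mul y x"
    by unfold_locales
      (simp_all add: mul_add_left mul_add_right mul_scale_left mul_scale_right)
  have "natural_basis scale (\<lambda>x y. mul y x) B"
    using assms(1) by (auto simp: natural_basis_def)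
  then show ?thesis
    using opposite.mul_basis_left assms(2) by blast
qed

text \<open>If \<open>(ey)e = e\<close>, the line through \<open>e\<^sup>2\<close>, in which every product with right factor \<open>e\<close>
  lies, contains \<open>e\<close> itself; being nonzero, \<open>e\<close> spans that line.\<close>

lemma square_of_regular_basis_element:
  assumes B: "natural_basis scale mul B" and e: "e \<in> B"
    and regular: "von_neumann_regular_element mul e"
  shows "\<exists>c. c \<noteq> 0 \<and> mul e e = scale c e"
proof -
  obtain y where y: "mul (mul e y) e = e"
    using regular by (auto simp: von_neumann_regular_element_def)
  obtain d where "mul (mul e y) e = scale d (mul e e)"
    using mul_basis_right[OF B e] by blast
  from y this have d: "e = scale d (mul e e)"
    by (rule trans[OF sym])
  have "e \<noteq> 0"
    using B e dependent_zero by (auto simp: natural_basis_def)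
  with d have "d \<noteq> 0"
    by (metis scale_zero_left)
  then have "scale (inverse d) (scale d (mul e e)) = mul e e"
    by simp
  with d have "mul e e = scale (inverse d) e"
    by metis
  moreover from \<open>d \<noteq> 0\<close> have "inverse d \<noteq> 0"
    by simp
  ultimately show ?thesis by blast
qed

text \<open>This trades the coordinates of \<open>e\<^sup>2\<close>, in which the graph is defined, for equations between
  vectors, the form in which regularity produces and consumes them.\<close>

lemma isolated_loops_iff_squares:
  assumes B: "natural_basis scale mul B"
  shows "isolated_loops (associated_graph scale mul B) \<longleftrightarrow>
    (\<forall>e\<in>B. \<exists>c. c \<noteq> 0 \<and> mul e e = scale c e)"
proof -
  have indep: "independent B" and in_span: "v \<in> span B" for v
    using B by (auto simp: natural_basis_def)
  let ?w = "structure_const scale mul B"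
  have "isolated_loops (associated_graph scale mul B) \<longleftrightarrow>
      (\<forall>e\<in>B. \<forall>f\<in>B. ?w e f \<noteq> 0 \<longleftrightarrow> f = e)"
    by (auto simp: isolated_loops_def associated_graph_def set_eq_iff)
  also have "\<dots> \<longleftrightarrow> (\<forall>e\<in>B. \<exists>c. c \<noteq> 0 \<and> mul e e = scale c e)"
  proof (rule ball_cong[OF refl], rule iffI)
    fix e assume e: "e \<in> B" and loop: "\<forall>f\<in>B. ?w e f \<noteq> 0 \<longleftrightarrow> f = e"
    have "{f. representation B (mul e e) f \<noteq> 0} = {e}"
      using loop e representation_ne_zero[of B "mul e e"] by (auto simp: structure_const_def)
    then have "mul e e = scale (?w e e) e"
      using sum_nonzero_representation_eq[OF indep in_span, of "mul e e"]
      by (simp add: structure_const_def)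
    then show "\<exists>c. c \<noteq> 0 \<and> mul e e = scale c e"
      using loop e by blast
  next
    fix e assume e: "e \<in> B" and "\<exists>c. c \<noteq> 0 \<and> mul e e = scale c e"
    then obtain c where c: "c \<noteq> 0" "mul e e = scale c e"
      by blast
    have "?w e f = (if f = e then c else 0)" for f
      using representation_scale[OF indep in_span, of c e] representation_basis[OF indep e]
      by (simp add: structure_const_def c)
    with c show "\<forall>f\<in>B. ?w e f \<noteq> 0 \<longleftrightarrow> f = e"
      by simp
  qed
  finally show ?thesis .
qed

lemma mul_linear_combinations:
  assumes "natural_basis scale mul B" and "finite S" and "S \<subseteq> B"
  shows "mul (\<Sum>b\<in>S. scale (f b) b) (\<Sum>b\<in>S. scale (g b) b) = (\<Sum>b\<in>S. scale (f b * g b) (mul b b))"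
proof -
  have "mul b (\<Sum>b'\<in>S. scale (g b') b') = scale (g b) (mul b b)" if "b \<in> S" for b
  proof -
    have orthogonal: "mul b b' = 0" if "b' \<in> S" "b' \<noteq> b" for b'
    proof -
      have "b \<in> B" and "b' \<in> B"
        using assms(3) \<open>b \<in> S\<close> that by auto
      then show ?thesis
        using assms(1) \<open>b' \<noteq> b\<close> by (simp add: natural_basis_def)
    qed
    have "mul b (\<Sum>b'\<in>S. scale (g b') b') = (\<Sum>b'\<in>S. if b' = b then scale (g b) (mul b b) else 0)"
      unfolding mul_sum_right
    proof (rule sum.cong[OF refl])
      fix b' assume "b' \<in> S"
      then show "mul b (scale (g b') b') = (if b' = b then scale (g b) (mul b b) else 0)"
        using orthogonal[of b'] by (cases "b' = b") (simp_all add: mul_scale_right)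
    qed
    then show ?thesis
      using assms(2) that by simp
  qed
  then show ?thesis
    by (simp add: mul_sum_left mul_scale_left)
qed

lemma regular_if_squares:
  assumes B: "natural_basis scale mul B"
    and squares: "\<forall>e\<in>B. \<exists>c. c \<noteq> 0 \<and> mul e e = scale c e"
  shows "von_neumann_regular mul"
  unfolding von_neumann_regular_def von_neumann_regular_element_def
proof
  fix x
  obtain w where w: "\<And>e. e \<in> B \<Longrightarrow> w e \<noteq> 0" "\<And>e. e \<in> B \<Longrightarrow> mul e e = scale (w e) e"
    using squares by metis
  define r where "r = representation B x"
  define S where "S = {b. r b \<noteq> 0}"
  have S: "finite S" "S \<subseteq> B"
    unfolding S_def r_def using finite_representation representation_ne_zero by auto
  have x: "x = (\<Sum>b\<in>S. scale (r b) b)"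
    unfolding S_def r_def using B
    by (simp add: sum_nonzero_representation_eq natural_basis_def)
  \<comment> \<open>Restricting to the support of \<open>x\<close> makes every coordinate \<open>r b\<close> invertible.\<close>
  define y where "y = (\<Sum>b\<in>S. scale (inverse (r b * w b * w b)) b)"
  have product: "mul (\<Sum>b\<in>S. scale (f b) b) (\<Sum>b\<in>S. scale (g b) b) = (\<Sum>b\<in>S. scale (f b * g b * w b) b)"
    for f g
    unfolding mul_linear_combinations[OF B S]
    by (rule sum.cong) (use S w in auto)
  have "mul (mul x y) x = (\<Sum>b\<in>S. scale (r b * inverse (r b * w b * w b) * w b * r b * w b) b)"
    unfolding y_def by (subst (1 2) x) (simp only: product)
  also have "\<dots> = x"
    unfolding x
  proof (rule sum.cong)
    fix b assume "b \<in> S"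
    then have "r b \<noteq> 0" "w b \<noteq> 0"
      using S w by (auto simp: S_def)
    then have "r b * inverse (r b * w b * w b) * w b * r b * w b = r b"
      by (simp add: field_simps)
    then show "scale (r b * inverse (r b * w b * w b) * w b * r b * w b) b = scale (r b) b"
      by simp
  qed simp
  finally show "\<exists>y. mul (mul x y) x = x"
    by blast
qed

end

theorem corollary3p27:
  fixes scale :: "'k::field \<Rightarrow> 'a::ab_group_add \<Rightarrow> 'a"
    and mul :: "'a \<Rightarrow> 'a \<Rightarrow> 'a"
  assumes "evolution_algebra scale mul"
  shows "von_neumann_regular mul \<longleftrightarrow>
    (\<forall>B. natural_basis scale mul B \<longrightarrow> isolated_loops (associated_graph scale mul B))"
proof -
  interpret evolution_algebra scale mul
    by (fact assms)
  show ?thesis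
  proof (intro iffI allI impI)
    fix B
    assume "von_neumann_regular mul" and "natural_basis scale mul B"
    then show "isolated_loops (associated_graph scale mul B)"
      using square_of_regular_basis_element
      by (auto simp: isolated_loops_iff_squares von_neumann_regular_def)
  next
    assume "\<forall>B. natural_basis scale mul B \<longrightarrow> isolated_loops (associated_graph scale mul B)"
    then show "von_neumann_regular mul"
      using ex_natural_basis isolated_loops_iff_squares regular_if_squares by blast
  qed
qed

end
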